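(* If the charging station sets $p^{BU}_{k,l,t}=v^{BU}_{l,t}-v_{-k}$ for every contract $(l,t,BU)$, then this pricing maximizes the ex-post social welfare.
   Context: User $k$ arrives at a charging station at time $t_k$ and is offered contracts $(l,t,BU)$ with $l\in\{1,\dots,L\}$ (energy), $t\in\{t_k+1,\dots,T\}$ (deadline), $BU\in\{0,\dots,BU_{max}\}$ (maximum additional battery utilization), at prices $p^{BU}_{k,l,t}$. User: the utility of contract $(l,t,BU)$ is a random variable $U^{BU}_{k,l,t}$ with realized value $u^{BU}_{k,l,t}$, known to the user only. Her payoff from the contract is $u^{BU}_{k,l,t}-p^{BU}_{k,l,t}$, and $0$ if she rejects all. She chooses $A^{BU}_{k,l,t}(\mathbf p_k)\in[0,1]$ with $\sum_{l,t,BU}A^{BU}_{k,l,t}\le1$ maximizing $\sum_{l,t,BU}A^{BU}_{k,l,t}(u^{BU}_{k,l,t}-p^{BU}_{k,l,t})$; if the maximum payoff over contracts is negative she rejects all, and if it is $0$ she accepts (ties between accepting and rejecting are resolved by accepting). Among several maximum-payoff contracts any convex combination may be chosen. Station: $v^{BU}_{l,t}$ is the optimal value of the linear program $\mathcal P^{BU}_{l,t}$ below (equal to $\infty$ if infeasible), and $v_{-k}$ is the optimal value when user $k$ accepts no contract, i.e. of the same program with $r_{k,t}=0$ and only the requirements of the existing vehicles. These do not depend on the prices. The station's profit is $p^{BU}_{k,l,t}-v^{BU}_{l,t}+v_{-k}$ if $(l,t,BU)$ is selected and $0$ if none is. Social welfare is user surplus (payoff) plus station profit. Ex-post social welfare maximization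 means that, for every realization of the utilities, the menu solves: maximize $\sum_{l,t,BU}(u^{BU}_{k,l,t}-v^{BU}_{l,t}+v_{-k})A^{BU}_{k,l,t}(\mathbf p_k)$ over $p^{BU}_{k,l,t}\ge0$. Linear program $\mathcal P^{BU}_{l,t_{\text{dead}}}$. $\mathcal K_0$: finite set of vehicles (EVs) already present; $i\in\mathcal K_0$ needs energy $N_i$ by deadline $w_i$ with remaining utilization allowance $BU_i$; put $N_k=l$, $w_k=t_{\text{dead}}$, $BU_k=BU$. Data: EV efficiencies $\eta_{i,c},\eta_{i,dc}\le1$, levels $\text{EV}^{i,\mathrm{ini}}$ at $t_k$, bounds $d_{i,\min},d_{i,\max}$, rate limits $R_{min},R_{max}$, harvested energy $\bar E^t$, storage capacity $B_{max}$, initial storage level $B^0$, station efficiencies $\eta_{c,cs},\eta_{d,cs}$, unit buying and selling prices $c_t\ge g_t$. Minimize $\sum_{t=t_k}^{T-1}(c_tq_t-g_tx_t)$ over $q_t,x_t,e_t,s_t,r^+_{i,t},r^-_{i,t}\ge0$ and real $r_{i,t},\text{EV}_{i,t},B^t$ subject to, for all relevant $t$ and $i\in\mathcal K_0\cup\{k\}$: $\sum_{t=t_k}^{w_i-1}r_{i,t}\ge N_i$; $r_{i,t}=r^+_{i,t}-r^-_{i,t}$, $R_{min}\le r_{i,t}\le R_{max}$; $r_{t,\text{charge}}=\sum_ir^+_{i,t}/\eta_{i,c}$, $r_{t,\text{discharge}}=\sum_i\eta_{i,dc}r^-_{i,t}$; $\text{EV}_{i,t+1}=\text{EV}_{i,t}+r_{i,t}$,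 $\text{EV}_{i,t_k}=\text{EV}^{i,\mathrm{ini}}$, $d_{i,\min}\le\text{EV}_{i,t}\le d_{i,\max}$; $B^{t+1}=B^t+\bar E^t\eta_{c,cs}-e_t/\eta_{d,cs}+s_t\eta_{c,cs}$, $0\le B^{t+1}\le B_{max}$, initial level $B^0$, $B^T=B^0$; $q_t-r_{t,\text{charge}}+r_{t,\text{discharge}}-x_t=s_t-e_t$; $\sum_{t=t_k}^{w_i-1}(r^+_{i,t}+r^-_{i,t})-N_i\le BU_i$. An EV takes part only before its deadline.
   Formalization: The prices can be negative, hence outside p≥0; so optimality is shown over menus of any sign, and over p≥0 when the prices are nonnegative. Assumed so that the values are defined: existing vehicles can be served, c_t≥0, all efficiencies in (0,1]. *)

theory Defs
  imports "HOL-Probability.Probability"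
begin

text \<open>
  A contract is a triple (energy, deadline, maximum additional battery utilization).
\<close>

type_synonym contract = "nat \<times> nat \<times> nat"

text \<open>
  The fields \<open>need\<close>, \<open>deadline\<close> and \<open>allowance\<close> describe the vehicles
  already present; their values at the arriving user are irrelevant, since they are overwritten
  by the terms of the contract under consideration.
\<close>

record 'i station =
  arrival :: nat                      (* t_k *)
  horizon :: nat                      (* T *)
  max_energy :: nat                   (* L *)
  max_BU :: nat                       (* BU_max *)
  present :: "'i set"                 (* K_0 *)
  user :: 'i                          (* k *)
  need :: "'i \<Rightarrow> real"                (* N_i *)
  deadline :: "'i \<Rightarrow> nat"             (* w_i *)
  allowance :: "'i \<Rightarrow> real"           (* BU_i *)
  eff_c :: "'i \<Rightarrow> real"               (* eta_{i,c} *)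
  eff_dc :: "'i \<Rightarrow> real"              (* eta_{i,dc} *)
  ev_ini :: "'i \<Rightarrow> real"
  d_min :: "'i \<Rightarrow> real"
  d_max :: "'i \<Rightarrow> real"
  R_min :: real
  R_max :: real
  harvest :: "nat \<Rightarrow> real"             (* E^t *)
  B_max :: real
  B_ini :: real                       (* B^0 *)
  eff_c_cs :: real
  eff_d_cs :: real
  buy :: "nat \<Rightarrow> real"                 (* c_t *)
  sell :: "nat \<Rightarrow> real"                (* g_t *)

definition valid_station :: "'i station \<Rightarrow> bool" where
  "valid_station S \<longleftrightarrow>
     arrival S < horizon S \<and> finite (present S) \<and> user S \<notin> present S \<and>
     (\<forall>i\<in>present S. arrival S < deadline S i \<and> deadline S i \<le> horizon S) \<and>
     (\<forall>i\<in>insert (user S) (present S).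
        0 < eff_c S i \<and> eff_c S i \<le> 1 \<and> 0 < eff_dc S i \<and> eff_dc S i \<le> 1) \<and>
     0 < eff_c_cs S \<and> eff_c_cs S \<le> 1 \<and> 0 < eff_d_cs S \<and> eff_d_cs S \<le> 1 \<and>
     (\<forall>t\<in>{arrival S..<horizon S}. 0 \<le> buy S t \<and> sell S t \<le> buy S t)"

definition contracts :: "'i station \<Rightarrow> contract set" where
  "contracts S = {1..max_energy S} \<times> {arrival S + 1..horizon S} \<times> {0..max_BU S}"

record 'i plan =
  bought :: "nat \<Rightarrow> real"            (* q_t *)
  sold :: "nat \<Rightarrow> real"              (* x_t *)
  drawn :: "nat \<Rightarrow> real"             (* e_t *)
  stored :: "nat \<Rightarrow> real"            (* s_t *)
  r_plus :: "'i \<Rightarrow> nat \<Rightarrow> real"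
  r_minus :: "'i \<Rightarrow> nat \<Rightarrow> real"
  rate :: "'i \<Rightarrow> nat \<Rightarrow> real"
  EV :: "'i \<Rightarrow> nat \<Rightarrow> real"
  storage :: "nat \<Rightarrow> real"

text \<open>
  The feasible set for a set \<open>I\<close> of vehicles with needs \<open>N\<close>, deadlines \<open>w\<close> and utilization
  allowances \<open>BU\<close>.  A vehicle takes part only in periods \<open>t < w i\<close>: the rate constraints and
  the sums over vehicles are restricted accordingly.
\<close>

definition charge :: "'i station \<Rightarrow> 'i set \<Rightarrow> ('i \<Rightarrow> nat) \<Rightarrow> 'i plan \<Rightarrow> nat \<Rightarrow> real" where
  "charge S I w z t = (\<Sum>i\<in>{i\<in>I. t < w i}. r_plus z i t / eff_c S i)"

definition discharge :: "'i station \<Rightarrow> 'i set \<Rightarrow> ('i \<Rightarrow> nat) \<Rightarrow> 'i plan \<Rightarrow> nat \<Rightarrow> real" where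
  "discharge S I w z t = (\<Sum>i\<in>{i\<in>I. t < w i}. eff_dc S i * r_minus z i t)"

definition feasible_plans ::
  "'i station \<Rightarrow> 'i set \<Rightarrow> ('i \<Rightarrow> real) \<Rightarrow> ('i \<Rightarrow> nat) \<Rightarrow> ('i \<Rightarrow> real) \<Rightarrow> 'i plan set" where
  "feasible_plans S I N w BU = {z.
     (\<forall>t\<in>{arrival S..<horizon S}. 0 \<le> bought z t \<and> 0 \<le> sold z t \<and> 0 \<le> drawn z t \<and> 0 \<le> stored z t) \<and>
     (\<forall>i\<in>I. \<forall>t\<in>{arrival S..<w i}.
        0 \<le> r_plus z i t \<and> 0 \<le> r_minus z i t \<and>
        rate z i t = r_plus z i t - r_minus z i t \<and> R_min S \<le> rate z i t \<and> rate z i t \<le> R_max S \<and>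
        EV z i (t + 1) = EV z i t + rate z i t) \<and>
     (\<forall>i\<in>I. EV z i (arrival S) = ev_ini S i) \<and>
     (\<forall>i\<in>I. \<forall>t\<in>{arrival S..w i}. d_min S i \<le> EV z i t \<and> EV z i t \<le> d_max S i) \<and>
     (\<forall>i\<in>I. (\<Sum>t\<in>{arrival S..<w i}. rate z i t) \<ge> N i) \<and>
     (\<forall>i\<in>I. (\<Sum>t\<in>{arrival S..<w i}. r_plus z i t + r_minus z i t) - N i \<le> BU i) \<and>
     storage z (arrival S) = B_ini S \<and> storage z (horizon S) = B_ini S \<and>
     (\<forall>t\<in>{arrival S..<horizon S}.
        storage z (t + 1) = storage z t + harvest S t * eff_c_cs S - drawn z t / eff_d_cs S + stored z t * eff_c_cs S \<and>
        0 \<le> storage z (t + 1) \<and> storage z (t + 1) \<le> B_max S \<and>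
        bought z t - charge S I w z t + discharge S I w z t - sold z t = stored z t - drawn z t)}"

definition cost :: "'i station \<Rightarrow> 'i plan \<Rightarrow> real" where
  "cost S z = (\<Sum>t\<in>{arrival S..<horizon S}. buy S t * bought z t - sell S t * sold z t)"

text \<open>The infimum over the empty set is \<open>\<infinity>\<close>, the value of an infeasible program.\<close>

definition lp_value ::
  "'i station \<Rightarrow> 'i set \<Rightarrow> ('i \<Rightarrow> real) \<Rightarrow> ('i \<Rightarrow> nat) \<Rightarrow> ('i \<Rightarrow> real) \<Rightarrow> ereal" where
  "lp_value S I N w BU = (INF z\<in>feasible_plans S I N w BU. ereal (cost S z))"

fun v_contract :: "'i station \<Rightarrow> contract \<Rightarrow> ereal" where
  "v_contract S (l, t, b) = lp_value S (insert (user S) (present S))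
     ((need S)(user S := real l)) ((deadline S)(user S := t)) ((allowance S)(user S := real b))"

text \<open>
  If the user accepts no contract she contributes no charging and no requirements, so she is
  left out of the set of vehicles.
\<close>

definition baseline_plans :: "'i station \<Rightarrow> 'i plan set" where
  "baseline_plans S = feasible_plans S (present S) (need S) (deadline S) (allowance S)"

definition v_without :: "'i station \<Rightarrow> ereal" where
  "v_without S = lp_value S (present S) (need S) (deadline S) (allowance S)"

text \<open>
  Menus and payoffs are extended-real valued, since the price of an infeasible contract is
  \<open>\<infinity>\<close>.  In the sums below a contract chosen with weight 0 contributes 0 even at an infinite
  price or cost, because \<open>0 * \<infinity> = 0\<close> in \<^typ>\<open>ereal\<close>.
\<close>

type_synonym menu = "contract \<Rightarrow> ereal"

definition payoff :: "(contract \<Rightarrow> real) \<Rightarrow> menu \<Rightarrow> contract \<Rightarrow> ereal" where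
  "payoff u p c = ereal (u c) - p c"

definition station_profit :: "'i station \<Rightarrow> menu \<Rightarrow> contract \<Rightarrow> ereal" where
  "station_profit S p c = p c - v_contract S c + v_without S"

definition choices :: "'i station \<Rightarrow> (contract \<Rightarrow> real) set" where
  "choices S = {A. (\<forall>c\<in>contracts S. 0 \<le> A c \<and> A c \<le> 1) \<and> (\<Sum>c\<in>contracts S. A c) \<le> 1}"

definition user_surplus :: "'i station \<Rightarrow> (contract \<Rightarrow> real) \<Rightarrow> menu \<Rightarrow> (contract \<Rightarrow> real) \<Rightarrow> ereal" where
  "user_surplus S u p A = (\<Sum>c\<in>contracts S. ereal (A c) * payoff u p c)"

text \<open>
  All choices the user may make: she is free to mix contracts of maximum payoff, but rejects
  everything if all payoffs are negative and accepts if some payoff is nonnegative.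
\<close>

definition user_responses :: "'i station \<Rightarrow> (contract \<Rightarrow> real) \<Rightarrow> menu \<Rightarrow> (contract \<Rightarrow> real) set" where
  "user_responses S u p = {A \<in> choices S.
     (\<forall>A'\<in>choices S. user_surplus S u p A' \<le> user_surplus S u p A) \<and>
     ((\<forall>c\<in>contracts S. payoff u p c < 0) \<longrightarrow> (\<forall>c\<in>contracts S. A c = 0)) \<and>
     ((\<exists>c\<in>contracts S. 0 \<le> payoff u p c) \<longrightarrow> (\<Sum>c\<in>contracts S. A c) = 1)}"

definition social_welfare :: "'i station \<Rightarrow> (contract \<Rightarrow> real) \<Rightarrow> (contract \<Rightarrow> real) \<Rightarrow> ereal" where
  "social_welfare S u A =
     (\<Sum>c\<in>contracts S. (ereal (u c) - v_contract S c + v_without S) * ereal (A c))"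

text \<open>The price is a transfer: it cancels from payoff plus profit.\<close>

lemma payoff_plus_profit:
  assumes "\<bar>p c\<bar> \<noteq> \<infinity>" and "\<bar>v_without S\<bar> \<noteq> \<infinity>"
  shows "payoff u p c + station_profit S p c = ereal (u c) - v_contract S c + v_without S"
  using assms unfolding payoff_def station_profit_def
  by (cases "p c"; cases "v_contract S c"; cases "v_without S") auto

text \<open>
  The marginal cost \<open>v_contract S c - v_without S\<close> is negative when the arriving vehicle is
  worth more to the station as storage than its own charging costs, so marginal-cost menus need
  not be nonnegative.
\<close>

definition nonneg_menus :: "'i station \<Rightarrow> menu set" where
  "nonneg_menus S = {p. \<forall>c\<in>contracts S. 0 \<le> p c}"

definition signed_menus :: "'i station \<Rightarrow> menu set" where
  "signed_menus S = {p. \<forall>c\<in>contracts S. p c \<noteq> -\<infinity>}"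

text \<open>The user always has a response, so quantifying over all responses is never vacuous.\<close>

lemma user_responses_nonempty:
  assumes "p \<in> signed_menus S"
  shows "user_responses S u p \<noteq> {}"
proof -
  let ?C = "contracts S"
  have fin: "finite ?C"
    by (simp add: contracts_def)
  show ?thesis
  proof (cases "\<exists>c\<in>?C. 0 \<le> payoff u p c")
    case False
    then have neg: "payoff u p c < 0" if "c \<in> ?C" for c
      using that by (auto simp: not_le)
    have "user_surplus S u p A \<le> 0" if "A \<in> choices S" for A
      unfolding user_surplus_def
    proof (rule sum_nonpos)
      fix c assume c: "c \<in> ?C"
      have "0 \<le> A c" "payoff u p c \<le> 0"
        using that c neg[OF c] by (auto simp: choices_def)
      then show "ereal (A c) * payoff u p c \<le> 0"
        using ereal_mult_left_mono[of "payoff u p c" 0 "ereal (A c)"] by simp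
    qed
    moreover have "user_surplus S u p (\<lambda>_. 0) = 0"
      unfolding user_surplus_def by (simp add: zero_ereal_def[symmetric])
    ultimately have "(\<lambda>_. 0) \<in> user_responses S u p"
      unfolding user_responses_def using False by (simp add: choices_def)
    then show ?thesis by blast
  next
    case True
    define m where "m = Max (payoff u p ` ?C)"
    have ne: "?C \<noteq> {}" using True by auto
    have "m \<in> payoff u p ` ?C"
      unfolding m_def using fin ne by (intro Max_in) auto
    then obtain c0 where c0: "c0 \<in> ?C" "payoff u p c0 = m" by auto
    have le: "payoff u p c \<le> m" if "c \<in> ?C" for c
      unfolding m_def using fin that by simp
    have m0: "0 \<le> m" using True le order_trans by blast
    have "m \<noteq> \<infinity>"
      using c0 assms unfolding payoff_def signed_menus_def by (cases "p c0") auto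
    then obtain d where d: "m = ereal d" "0 \<le> d" using m0 by (cases m) auto
    define A0 :: "contract \<Rightarrow> real" where "A0 = (\<lambda>c. if c = c0 then 1 else 0)"
    have s1: "(\<Sum>c\<in>?C. A0 c) = 1"
      using fin c0 by (simp add: A0_def)
    have "user_surplus S u p A0 = (\<Sum>c\<in>?C. if c = c0 then m else 0)"
      unfolding user_surplus_def A0_def using c0
      by (intro sum.cong) (auto simp: one_ereal_def[symmetric] zero_ereal_def[symmetric])
    also have "\<dots> = m" using fin c0 by simp
    finally have val: "user_surplus S u p A0 = m" .
    have "user_surplus S u p A \<le> m" if A: "A \<in> choices S" for A
    proof -
      have "user_surplus S u p A \<le> (\<Sum>c\<in>?C. ereal (A c) * ereal d)"
        unfolding user_surplus_def
      proof (rule sum_mono)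
        fix c assume c: "c \<in> ?C"
        have "0 \<le> ereal (A c)" using A c by (auto simp: choices_def)
        then show "ereal (A c) * payoff u p c \<le> ereal (A c) * ereal d"
          using le[OF c] d(1) by (intro ereal_mult_left_mono) auto
      qed
      also have "\<dots> = ereal ((\<Sum>c\<in>?C. A c) * d)"
        by (simp add: sum_distrib_right)
      also have "\<dots> \<le> ereal d"
        using A d(2) mult_right_mono[of "\<Sum>c\<in>?C. A c" 1 d] by (simp add: choices_def)
      finally show ?thesis using d by simp
    qed
    moreover have "A0 \<in> choices S"
      using s1 by (simp add: choices_def) (simp add: A0_def)
    moreover have "\<not> (\<forall>c\<in>?C. payoff u p c < 0)"
      using True by (meson not_le)
    ultimately have "A0 \<in> user_responses S u p"
      unfolding user_responses_def using s1 val by (simp; blast)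
    then show ?thesis by blast
  qed
qed

text \<open>
  \<open>p\<close> solves the ex-post problem over the menus in \<open>P\<close>: for every realization of the utilities,
  and however the user picks among her responses, no menu in \<open>P\<close> achieves a higher welfare.
\<close>

definition maximizes_ex_post_welfare ::
  "'i station \<Rightarrow> 'w measure \<Rightarrow> (contract \<Rightarrow> 'w \<Rightarrow> real) \<Rightarrow> menu set \<Rightarrow> menu \<Rightarrow> bool" where
  "maximizes_ex_post_welfare S M U P p \<longleftrightarrow> p \<in> P \<and>
     (\<forall>\<omega>\<in>space M. let u = (\<lambda>c. U c \<omega>) in
        \<forall>A\<in>user_responses S u p. \<forall>p'\<in>P. \<forall>A'\<in>user_responses S u p'.
          social_welfare S u A' \<le> social_welfare S u A)"

end

(* At marginal-cost prices the user's payoff from each contract is its welfare contribution, so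
   her own surplus maximization already maximizes welfare over all choices, in particular over
   those induced by any other menu.  This needs all prices to be well defined, i.e. the programs
   to be bounded below: since c_t >= g_t and c_t >= 0, the cost is at least the sum of
   c_t (q_t - x_t), and the energy balance bounds the net purchase q_t - x_t from below by the
   rate limits and the storage capacity. *)
theory Submission
  imports Defs
begin

text \<open>By the energy balance, the net purchase is vehicle charge minus discharge, plus what
  enters the storage, minus what leaves it. Efficiencies at most 1 only raise charge minus discharge
  above the sum of the net rates, and nonnegativity of the next level lets the storage deliver no
  more than its current level plus the harvest.\<close>

lemma net_purchase_ge:
  assumes S: "valid_station S" and I: "I \<subseteq> insert (user S) (present S)"
    and z: "z \<in> feasible_plans S I N w BU" and t: "t \<in> {arrival S..<horizon S}"
  shows "(\<Sum>i\<in>{i\<in>I. t < w i}. R_min S) - max (B_max S) (B_ini S) - harvest S t * eff_c_cs S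
    \<le> bought z t - sold z t"
proof -
  have rates: "\<forall>i\<in>I. \<forall>t\<in>{arrival S..<w i}.
      0 \<le> r_plus z i t \<and> 0 \<le> r_minus z i t \<and>
      rate z i t = r_plus z i t - r_minus z i t \<and> R_min S \<le> rate z i t \<and> rate z i t \<le> R_max S \<and>
      EV z i (t + 1) = EV z i t + rate z i t"
    using z unfolding feasible_plans_def mem_Collect_eq by - (elim conjE, assumption)
  have "(\<Sum>i\<in>{i\<in>I. t < w i}. R_min S)
      \<le> (\<Sum>i\<in>{i\<in>I. t < w i}. r_plus z i t / eff_c S i - eff_dc S i * r_minus z i t)"
  proof (rule sum_mono)
    fix i assume i: "i \<in> {i\<in>I. t < w i}"
    then have "i \<in> I" and "t \<in> {arrival S..<w i}" using t by auto
    from bspec[OF bspec[OF rates this(1)] this(2)]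
    have r: "0 \<le> r_plus z i t" "0 \<le> r_minus z i t" "R_min S \<le> r_plus z i t - r_minus z i t"
      by linarith+
    have eff: "0 < eff_c S i" "eff_c S i \<le> 1" "eff_dc S i \<le> 1"
      using S i I by (auto simp: valid_station_def)
    have "r_plus z i t \<le> r_plus z i t / eff_c S i"
      using r eff by (simp add: pos_le_divide_eq mult_left_le)
    moreover have "eff_dc S i * r_minus z i t \<le> r_minus z i t"
      using r eff mult_right_mono[of "eff_dc S i" 1 "r_minus z i t"] by simp
    ultimately show "R_min S \<le> r_plus z i t / eff_c S i - eff_dc S i * r_minus z i t"
      using r by linarith
  qed
  then have vehicles: "(\<Sum>i\<in>{i\<in>I. t < w i}. R_min S) \<le> charge S I w z t - discharge S I w z t"
    by (simp add: charge_def discharge_def sum_subtractf)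
  have eff: "eff_c_cs S \<le> 1" "0 < eff_d_cs S" "eff_d_cs S \<le> 1"
    using S by (auto simp: valid_station_def)
  have nonneg: "\<forall>t\<in>{arrival S..<horizon S}.
      0 \<le> bought z t \<and> 0 \<le> sold z t \<and> 0 \<le> drawn z t \<and> 0 \<le> stored z t"
    using z unfolding feasible_plans_def mem_Collect_eq by - (elim conjE, assumption)
  have ini: "storage z (arrival S) = B_ini S"
    using z unfolding feasible_plans_def mem_Collect_eq by - (elim conjE, assumption)
  have balance: "\<forall>t\<in>{arrival S..<horizon S}.
      storage z (t + 1) = storage z t + harvest S t * eff_c_cs S - drawn z t / eff_d_cs S
        + stored z t * eff_c_cs S \<and>
      0 \<le> storage z (t + 1) \<and> storage z (t + 1) \<le> B_max S \<and>
      bought z t - charge S I w z t + discharge S I w z t - sold z t = stored z t - drawn z t"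
    using z unfolding feasible_plans_def mem_Collect_eq by - (elim conjE, assumption)
  have fz: "0 \<le> drawn z t" "0 \<le> stored z t" "0 \<le> storage z (t + 1)"
    "storage z (t + 1) = storage z t + harvest S t * eff_c_cs S - drawn z t / eff_d_cs S
       + stored z t * eff_c_cs S"
    "bought z t - charge S I w z t + discharge S I w z t - sold z t = stored z t - drawn z t"
    using bspec[OF nonneg t] bspec[OF balance t] by - (elim conjE, assumption)+
  \<comment> \<open>The capacity constraint speaks only of levels at \<open>t + 1\<close>, so the
    level at \<open>arrival S\<close> is bounded by \<open>B_ini S\<close> instead.\<close>
  have level: "storage z t \<le> max (B_max S) (B_ini S)"
  proof (cases "t = arrival S")
    case True
    then show ?thesis using ini by simp
  next
    case False
    then have "t - 1 \<in> {arrival S..<horizon S}" and "t - 1 + 1 = t" using t by auto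
    then have "storage z t \<le> B_max S" using bspec[OF balance, of "t - 1"] by simp
    then show ?thesis by simp
  qed
  have "drawn z t \<le> drawn z t / eff_d_cs S"
    using fz(1) eff by (simp add: pos_le_divide_eq mult_left_le)
  moreover have "stored z t * eff_c_cs S \<le> stored z t"
    using fz(2) eff by (simp add: mult_left_le)
  ultimately show ?thesis using vehicles level fz by linarith
qed

lemma cost_bounded_below:
  assumes S: "valid_station S" and I: "I \<subseteq> insert (user S) (present S)"
  obtains K where "\<And>z. z \<in> feasible_plans S I N w BU \<Longrightarrow> K \<le> cost S z"
proof
  fix z assume z: "z \<in> feasible_plans S I N w BU"
  let ?b = "\<lambda>t. (\<Sum>i\<in>{i\<in>I. t < w i}. R_min S) - max (B_max S) (B_ini S)
    - harvest S t * eff_c_cs S"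
  \<comment> \<open>The witness \<open>K\<close> is fixed here by unification; this is possible
    because \<open>?b\<close> does not depend on \<open>z\<close>.\<close>
  show "(\<Sum>t\<in>{arrival S..<horizon S}. buy S t * ?b t) \<le> cost S z"
    unfolding cost_def
  proof (rule sum_mono)
    fix t assume t: "t \<in> {arrival S..<horizon S}"
    have "0 \<le> buy S t" "sell S t \<le> buy S t" "0 \<le> sold z t"
      using S z t by (auto simp: valid_station_def feasible_plans_def)
    then have "buy S t * ?b t \<le> buy S t * (bought z t - sold z t)"
      and "sell S t * sold z t \<le> buy S t * sold z t"
      using net_purchase_ge[OF S I z t] by (auto intro: mult_left_mono mult_right_mono)
    then show "buy S t * ?b t \<le> buy S t * bought z t - sell S t * sold z t"
      by (simp add: right_diff_distrib)
  qed
qed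

text \<open>An infeasible program obeys the same bound, its infimum being \<infinity>.\<close>

lemma lp_value_not_MInfty:
  assumes "valid_station S" and "I \<subseteq> insert (user S) (present S)"
  shows "lp_value S I N w BU \<noteq> -\<infinity>"
proof -
  obtain K where "\<And>z. z \<in> feasible_plans S I N w BU \<Longrightarrow> K \<le> cost S z"
    using cost_bounded_below[OF assms] by blast
  then have "ereal K \<le> lp_value S I N w BU"
    unfolding lp_value_def by (intro INF_greatest) simp
  then show ?thesis by auto
qed

lemma v_contract_not_MInfty:
  assumes "valid_station S"
  shows "v_contract S c \<noteq> -\<infinity>"
  by (cases c) (simp add: lp_value_not_MInfty[OF assms])

text \<open>Any baseline plan bounds the value from above. Finiteness keeps \<infinity> -
  \<infinity> out of the prices.\<close>

lemma v_without_finite: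
  assumes "valid_station S" and "baseline_plans S \<noteq> {}"
  shows "\<bar>v_without S\<bar> \<noteq> \<infinity>"
proof -
  obtain z where z: "z \<in> feasible_plans S (present S) (need S) (deadline S) (allowance S)"
    using assms(2) by (auto simp: baseline_plans_def)
  have "v_without S \<le> ereal (cost S z)"
    unfolding v_without_def lp_value_def by (rule INF_lower[OF z])
  moreover have "v_without S \<noteq> -\<infinity>"
    unfolding v_without_def by (rule lp_value_not_MInfty[OF assms(1)]) auto
  ultimately show ?thesis by auto
qed

lemma social_welfare_eq_user_surplus:
  assumes "\<bar>v_without S\<bar> \<noteq> \<infinity>"
    and "\<And>c. c \<in> contracts S \<Longrightarrow> p c = v_contract S c - v_without S"
  shows "social_welfare S u A = user_surplus S u p A"
  unfolding social_welfare_def user_surplus_def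
proof (rule sum.cong[OF refl])
  fix c assume "c \<in> contracts S"
  \<comment> \<open>For an infeasible contract both sides are -\<infinity>; finiteness of
    \<open>v_without S\<close> lets the subtraction distribute.\<close>
  then have "payoff u p c = ereal (u c) - v_contract S c + v_without S"
    using assms unfolding payoff_def
    by (cases "v_contract S c"; cases "v_without S") auto
  then show "(ereal (u c) - v_contract S c + v_without S) * ereal (A c)
      = ereal (A c) * payoff u p c"
    by (simp add: mult.commute)
qed

text \<open>The set \<open>choices S\<close> does not depend on the menu, so a response to any rival
  menu competes in the maximization that defines a response to \<open>p\<close>. Leaving
  \<open>P\<close> arbitrary serves signed and nonnegative menus alike.\<close>

lemma marginal_cost_menu_maximizes:
  assumes "\<bar>v_without S\<bar> \<noteq> \<infinity>"
    and "\<And>c. c \<in> contracts S \<Longrightarrow> p c = v_contract S c - v_without S"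
    and "p \<in> P"
  shows "maximizes_ex_post_welfare S M U P p"
proof -
  have "social_welfare S u A = user_surplus S u p A" for u A
    by (rule social_welfare_eq_user_surplus[OF assms(1)]) (rule assms(2))
  then show ?thesis
    using assms(3) by (simp add: maximizes_ex_post_welfare_def Let_def user_responses_def)
qed

theorem theorem3:
  fixes S :: "'i station" and M :: "'w measure" and U :: "contract \<Rightarrow> 'w \<Rightarrow> real" and p :: menu
  assumes "valid_station S"
    and "baseline_plans S \<noteq> {}"
    and "prob_space M"
    and "\<And>c. c \<in> contracts S \<Longrightarrow> U c \<in> borel_measurable M"
    and "\<And>c. c \<in> contracts S \<Longrightarrow> p c = v_contract S c - v_without S"
  shows "maximizes_ex_post_welfare S M U (signed_menus S) p \<and>
    (p \<in> nonneg_menus S \<longrightarrow> maximizes_ex_post_welfare S M U (nonneg_menus S) p)"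
proof -
  note fin = v_without_finite[OF assms(1,2)]
  \<comment> \<open>A price may be \<infinity>, for an infeasible contract, but boundedness of the
    programs excludes -\<infinity>.\<close>
  have "p c \<noteq> -\<infinity>" if "c \<in> contracts S" for c
    using assms(5)[OF that] fin v_contract_not_MInfty[OF assms(1), of c]
    by (cases "v_contract S c"; cases "v_without S") auto
  then have "p \<in> signed_menus S"
    by (simp add: signed_menus_def)
  then show ?thesis
    using marginal_cost_menu_maximizes[where p = p, OF fin assms(5)] by blast
qed

end
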